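(* Let $\{\mathbf{X}_t\}_{t\in\mathbf{T}}$ be a regime-based multivariate time series of dimension $d$ with $r>1$ regimes, regime indices $C_t\in\{1,\dots,r\}$ and window causal graphs $\mathcal{G}_w^1,\dots,\mathcal{G}_w^r$, and let $h^{j,k}_{*}$, $\widehat{h}^{j,k}_{\mathbf{T}}$ and $k(\mathbf{T})$ be as defined in the context. Let $j\in\{1,\dots,d\}$, $k\in\{1,\dots,r\}$ and a time point $t$ be given. Suppose that: 1. $C_t=k$; 2. the function $h^{j,k}_{*}(\mathbf{MB}(x_t^j;\mathcal{G}_w^k))$ approximates $x_t^j$ within a bounded error, i.e. there exists $M>0$ such that for all values $x_t^j$, $$|x_t^j-h^{j,k}_{*}(\mathbf{MB}(x_t^j;\mathcal{G}_w^k))|<M;$$ 3. the estimate $\widehat{h}^{j,k}_{\mathbf{T}}$ converges to the best function $h^{j,k}_{*}$ in the sense that $$\lim_{k(\mathbf{T})\to+\infty}\int_{\mathbf{S}}\left(\widehat{h}^{j,k}_{\mathbf{T}}(\mathbf{S})-h^{j,k}_{*}(\mathbf{S})\right)^2 dP(\mathbf{S})=0,$$ where $\mathbf{S}$ is any subset of $\mathbf{X}$. Then, for any other regime $\ell\in\{1,\dots,r\}$, $\ell\neq k$, $$\lim_{k(\mathbf{T})\to+\infty}\mathbb{E}\left[\left(X_t^j-\widehat{h}^{j,k}_{\mathbf{T}}(\mathbf{MB}(X_t^j;\mathcal{G}_w^k))\right)^2\right]\le\lim_{k(\mathbf{T})\to+\infty}\mathbb{E}\left[\left(X_t^j-\w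idehat{h}^{j,\ell}_{\mathbf{T}}(\mathbf{MB}(X_t^j;\mathcal{G}_w^\ell))\right)^2\right].$$
   Context: **Time series and regimes.** $\{\mathbf{X}_t\}_{t\in\mathbf{T}}=\{X_t^j\}_{t\in\mathbf{T},\,1\le j\le d}$ is a multivariate time series of dimension $d$ observed over the set of time points $\mathbf{T}$; lower-case letters such as $x_t^j$ denote values of the corresponding random variables. A hidden context variable $C_t\in\{1,\dots,r\}$ indicates the regime to which time point $t$ belongs. The series is a regime-based multivariate time series: it is partitioned into $r>1$ disjoint regimes encoded by $C_t$, regime $k$ has its own window causal graph $\mathcal{G}_w^k$, and $\mathcal{G}_w^{k_1}\ne\mathcal{G}_w^{k_2}$ whenever $k_1\neq k_2$. A window causal graph is a directed acyclic graph describing the direct causal relations (lagged and instantaneous) among the variables in a finite time window whose length is governed by the maximal lag $\tau_{\max}$ between a direct cause and its effect. Within each regime causal relations are invariant over time. The data satisfy the structural causal model $$X_t^j=\sum_{k=1}^r\mathbf{1}_{C_t=k}\; g^{j,C_t}(\mathbf{Pa}(X_t^j;\mathcal{G}_w^{C_t}),\epsilon_t^j),\qquad t\in\mathbf{T},$$ where $g^{j,k}$ is deterministic, $\mathbf{Pa}(X_t^j;\mathcal{G}_w^{k})$ is the set of parents (lagged and instantaneous) of $X_t^j$ in $\mathcal{G}_w^k$, and the noise terms $\epsilon_t^j$ are independent. All hidden confounding between observed variables is captured by $(C_t)_t$. The window causal graph of each regime is assumed known. **Markov blankets.** $\mathbf{MB}(X_t^j;\mathcal{G}_w^k)$ is the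 Markov blanket of $X_t^j$ in regime $k$: the set of its parents, children and spouses (other parents of its children) according to $\mathcal{G}_w^k$; conditionally on it, $X_t^j$ is independent of all other variables. $\mathbf{MB}(x_t^j;\mathcal{G}_w^k)$ denotes the values of these variables. When used as a set of covariates around time $t$, $\mathbf{X}$ stands for the collection of all variables $X_{t'}^i$ with $1\le i\le d$ and $t-\tau_{\max}\le t'\le t+\tau_{\max}$; $\mathbf{X}_{-t}^{-j}$ is this collection with $X_t^j$ removed. The Markov blanket of $X_t^j$ is contained in $\mathbf{X}_{-t}^{-j}$. **Predictors.** $\mathcal{H}$ is a class of functions used as predictors. For $1\le k\le r$, the optimal ("best") predictor $h^{j,k}_{*}\in\mathcal{H}$ of $X_t^j$ in regime $k$ (i.e. when $C_t=k$) minimizes the expected squared error. It is a standing fact (recalled from the literature) that the covariates can be restricted to the Markov blanket in the true regime: $$\operatorname*{argmin}_{h^{j,C_t}\in\mathcal{H}}\mathbb{E}\left[(X_t^j-h^{j,C_t}(\mathbf{X}_{-t}^{-j}))^2\right]=\operatorname*{argmin}_{h^{j,C_t}\in\mathcal{H}}\mathbb{E}\left[(X_t^j-h^{j,C_t}(\mathbf{MB}(X_t^j;\mathcal{G}_w^{C_t})))^2\right].$$ The estimate $\widehat{h}^{j,k}_{\mathbf{T}}$ is obtained by empirical risk minimization on the time points of regime $k$: $$\widehat{h}^{j,k}_{\mathbf{T}}(\mathbf{MB}(x_t^j;\mathcal{G}_w^k))=\operatorname*{argmin}_{h^{j,C_t}\in\mathcal{H}}\sum_{t\in\mathbf{T}}\mathbf{1}_{C_t=k}\left(x_t^j-h^{j,C_t}(\mathbf{MB}(x_t^j;\mathcal{G}_w^{C_t}))\right)^2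 .$$ **Further notation.** $k(\mathbf{T})=\sum_{t\in\mathbf{T}}\mathbf{1}_{C_t=k}$ is the number of time points of $\mathbf{T}$ in regime $k$. The integral $\int_{\mathbf{S}}\cdot\,dP(\mathbf{S})$ is taken over all possible values of the set of variables $\mathbf{S}$, with respect to its probability distribution $P$; $\widehat{h}^{j,k}_{\mathbf{T}}(\mathbf{S})$ and $h^{j,k}_{*}(\mathbf{S})$ denote the predictors applied to the covariates $\mathbf{S}$. *)

theory Defs
  imports "HOL-Probability.Probability"
begin

text \<open>
  A node \<open>(i, \<delta>)\<close> stands for the variable \<open>X\<^sub>t\<^sub>+\<^sub>\<delta>\<^sup>i\<close>, the time offset being relative
  to a reference time \<open>t\<close>.  The variable \<open>X\<^sub>t\<^sup>j\<close> itself is \<open>(j, 0)\<close>.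
\<close>

type_synonym node = "nat \<times> int"
type_synonym predictor = "(node \<Rightarrow> real) \<Rightarrow> real"

definition window :: "nat \<Rightarrow> nat \<Rightarrow> node set" where
  "window d \<tau> = {1..d} \<times> {- int \<tau>..int \<tau>}"

text \<open>
  The window reaches \<open>\<tau>\<close> steps into the past and into the future, so that it contains every
  parent, child and spouse of a node \<open>(j, 0)\<close>.  The last clause says that the causal relations are
  the same at all times of the window.
\<close>

definition window_causal_graph :: "nat \<Rightarrow> nat \<Rightarrow> (node \<times> node) set \<Rightarrow> bool" where
  "window_causal_graph d \<tau> G \<longleftrightarrow>
     G \<subseteq> window d \<tau> \<times> window d \<tau> \<and> acyclic G \<and>
     (\<forall>i a j b. ((i, a), (j, b)) \<in> G \<longrightarrow> a \<le> b \<and> b - a \<le> int \<tau>) \<and>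
     (\<forall>i a j b c. ((i, a), (j, b)) \<in> G \<and> (i, a + c) \<in> window d \<tau> \<and> (j, b + c) \<in> window d \<tau>
        \<longrightarrow> ((i, a + c), (j, b + c)) \<in> G)"

definition parents :: "(node \<times> node) set \<Rightarrow> node \<Rightarrow> node set" where
  "parents G v = {u. (u, v) \<in> G}"

definition children :: "(node \<times> node) set \<Rightarrow> node \<Rightarrow> node set" where
  "children G v = {w. (v, w) \<in> G}"

definition spouses :: "(node \<times> node) set \<Rightarrow> node \<Rightarrow> node set" where
  "spouses G v = (\<Union>w\<in>children G v. parents G w) - {v}"

definition markov_blanket :: "(node \<times> node) set \<Rightarrow> node \<Rightarrow> node set" where
  "markov_blanket G v = parents G v \<union> children G v \<union> spouses G v"

text \<open>The values at time \<open>t\<close> of the covariates \<open>S\<close> along a trajectory \<open>x\<close>.\<close>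

definition covs :: "(int \<Rightarrow> nat \<Rightarrow> real) \<Rightarrow> int \<Rightarrow> node set \<Rightarrow> node \<Rightarrow> real" where
  "covs x t S = restrict (\<lambda>(i, \<delta>). x (t + \<delta>) i) S"

text \<open>
  \<open>X s i\<close> is the variable \<open>X\<^sub>s\<^sup>i\<close>, \<open>TT\<close> the set of time points at which the structural equations
  hold, \<open>C\<close> the regime assignment and \<open>G k\<close> the window causal graph of regime \<open>k\<close>.  The process is
  indexed by all integers only so that the windows around the times in \<open>TT\<close> make sense.
\<close>

locale regime_time_series = prob_space M
  for M :: "'a measure" +
  fixes d r \<tau> :: nat
    and TT :: "int set"
    and C :: "int \<Rightarrow> nat"
    and G :: "nat \<Rightarrow> (node \<times> node) set"
    and g :: "nat \<Rightarrow> nat \<Rightarrow> (node \<Rightarrow> real) \<Rightarrow> real \<Rightarrow> real"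
    and \<epsilon> X :: "int \<Rightarrow> nat \<Rightarrow> 'a \<Rightarrow> real"
  assumes regimes: "r > 1"
    and regime_range: "\<And>s. s \<in> TT \<Longrightarrow> C s \<in> {1..r}"
    and graphs: "\<And>k. k \<in> {1..r} \<Longrightarrow> window_causal_graph d \<tau> (G k)"
    and graphs_distinct:
      "\<And>k1 k2. k1 \<in> {1..r} \<Longrightarrow> k2 \<in> {1..r} \<Longrightarrow> k1 \<noteq> k2 \<Longrightarrow> G k1 \<noteq> G k2"
    and random_variables: "\<And>s i. i \<in> {1..d} \<Longrightarrow> X s i \<in> borel_measurable M"
    and noise_indep: "indep_vars (\<lambda>_. borel) (\<lambda>(s, i). \<epsilon> s i) (TT \<times> {1..d})"
    and structural_equations:
      "\<And>s i \<omega>. s \<in> TT \<Longrightarrow> i \<in> {1..d} \<Longrightarrow> \<omega> \<in> space M \<Longrightarrow>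
         X s i \<omega> = (\<Sum>k = 1..r. of_bool (C s = k) *
           g i (C s) (covs (\<lambda>s i. X s i \<omega>) s (parents (G (C s)) (i, 0))) (\<epsilon> s i \<omega>))"

definition regime_count :: "(int \<Rightarrow> nat) \<Rightarrow> nat \<Rightarrow> int set \<Rightarrow> nat" where
  "regime_count C k T = (\<Sum>s\<in>T. of_bool (C s = k))"

text \<open>
  A predictor that uses only the covariates \<open>S\<close> is a member of the class that is a function of the
  coordinates in \<open>S\<close>.  In this way predictors on different sets of covariates belong to one class,
  and a predictor on \<open>S\<close> is also a predictor on every superset of \<open>S\<close>.
\<close>

definition predictors_on :: "predictor set \<Rightarrow> node set \<Rightarrow> predictor set" where
  "predictors_on H S = {h \<in> H. \<forall>x y. (\<forall>v\<in>S. x v = y v) \<longrightarrow> h x = h y}"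

text \<open>
  The expected squared error is taken in \<open>[0, \<infinity>]\<close>: the Bochner integral would assign the value 0
  to predictors whose squared error is not integrable.
\<close>

definition sq_risk ::
    "'a measure \<Rightarrow> (int \<Rightarrow> nat \<Rightarrow> 'a \<Rightarrow> real) \<Rightarrow> int \<Rightarrow> nat \<Rightarrow> node set \<Rightarrow> predictor \<Rightarrow> ennreal" where
  "sq_risk M X t j S h =
     (\<integral>\<^sup>+ \<omega>. ennreal ((X t j \<omega> - h (covs (\<lambda>s i. X s i \<omega>) t S))\<^sup>2) \<partial>M)"

definition best_predictors ::
    "'a measure \<Rightarrow> (int \<Rightarrow> nat \<Rightarrow> 'a \<Rightarrow> real) \<Rightarrow> predictor set \<Rightarrow> int \<Rightarrow> nat \<Rightarrow> node set
      \<Rightarrow> predictor set" where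
  "best_predictors M X H t j S =
     {h \<in> predictors_on H S. \<forall>h'\<in>predictors_on H S. sq_risk M X t j S h \<le> sq_risk M X t j S h'}"

text \<open>
  Equality of the sets of optimal predictors on \<open>S\<close> and on \<open>S'\<close>, where predictors are identified
  if their predictions at time \<open>t\<close> agree almost surely.
\<close>

definition same_best_predictors ::
    "'a measure \<Rightarrow> (int \<Rightarrow> nat \<Rightarrow> 'a \<Rightarrow> real) \<Rightarrow> predictor set \<Rightarrow> int \<Rightarrow> nat
      \<Rightarrow> node set \<Rightarrow> node set \<Rightarrow> bool" where
  "same_best_predictors M X H t j S S' \<longleftrightarrow>
     (\<forall>h\<in>best_predictors M X H t j S. \<exists>h'\<in>best_predictors M X H t j S'.
        AE \<omega> in M. h (covs (\<lambda>s i. X s i \<omega>) t S) = h' (covs (\<lambda>s i. X s i \<omega>) t S')) \<and>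
     (\<forall>h'\<in>best_predictors M X H t j S'. \<exists>h\<in>best_predictors M X H t j S.
        AE \<omega> in M. h (covs (\<lambda>s i. X s i \<omega>) t S) = h' (covs (\<lambda>s i. X s i \<omega>) t S'))"

text \<open>Empirical risk minimisers on the time points \<open>T\<close> of regime \<open>k\<close>, for observed values \<open>x\<close>.\<close>

definition emp_risk ::
    "(int \<Rightarrow> nat \<Rightarrow> real) \<Rightarrow> (int \<Rightarrow> nat) \<Rightarrow> int set \<Rightarrow> nat \<Rightarrow> nat \<Rightarrow> node set \<Rightarrow> predictor \<Rightarrow> real" where
  "emp_risk x C T j k S h = (\<Sum>s\<in>T. of_bool (C s = k) * (x s j - h (covs x s S))\<^sup>2)"

definition erm_predictors ::
    "(int \<Rightarrow> nat \<Rightarrow> real) \<Rightarrow> (int \<Rightarrow> nat) \<Rightarrow> predictor set \<Rightarrow> int set \<Rightarrow> nat \<Rightarrow> nat \<Rightarrow> node set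
      \<Rightarrow> predictor set" where
  "erm_predictors x C H T j k S =
     {h \<in> predictors_on H S.
        \<forall>h'\<in>predictors_on H S. emp_risk x C T j k S h \<le> emp_risk x C T j k S h'}"

definition covs_distr ::
    "'a measure \<Rightarrow> (int \<Rightarrow> nat \<Rightarrow> 'a \<Rightarrow> real) \<Rightarrow> int \<Rightarrow> node set \<Rightarrow> (node \<Rightarrow> real) measure" where
  "covs_distr M X t S = distr M (Pi\<^sub>M S (\<lambda>_. borel)) (\<lambda>\<omega>. covs (\<lambda>s i. X s i \<omega>) t S)"

end

theory Submission
  imports Defs
begin

text \<open>
  The optimal predictor on the Markov blanket of the true regime has the same risk as an optimal
  predictor on the whole window without \<open>X\<^sub>t\<^sup>j\<close>, so no predictor on any other covariates of the
  window, in particular no estimate of another regime, has a smaller risk.  Since the estimate of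
  the true regime converges to the optimal predictor in the mean square, its risk converges to
  this minimal risk.
\<close>

text \<open>A weighted Young inequality bounds each risk by \<open>(1 + \<delta>)\<close> times the
  risk of \<open>A\<close> plus a multiple of the mean square distance of \<open>B n\<close> to
  \<open>A\<close>. For fixed \<open>\<delta>\<close> the latter vanishes in the limit; then
  \<open>\<delta>\<close> tends to 0.\<close>

lemma limsup_nn_integral_sq_le:
  fixes Y A :: "'a \<Rightarrow> real" and B :: "nat \<Rightarrow> 'a \<Rightarrow> real"
  assumes [measurable]: "Y \<in> borel_measurable M" "A \<in> borel_measurable M"
      "\<And>n. B n \<in> borel_measurable M"
    and fin: "(\<integral>\<^sup>+ \<omega>. ennreal ((Y \<omega> - A \<omega>)\<^sup>2) \<partial>M) < \<infinity>"
    and conv: "(\<lambda>n. \<integral>\<^sup>+ \<omega>. ennreal ((B n \<omega> - A \<omega>)\<^sup>2) \<partial>M) \<longlonglongrightarrow> 0"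
  shows "limsup (\<lambda>n. \<integral>\<^sup>+ \<omega>. ennreal ((Y \<omega> - B n \<omega>)\<^sup>2) \<partial>M) \<le> (\<integral>\<^sup>+ \<omega>. ennreal ((Y \<omega> - A \<omega>)\<^sup>2) \<partial>M)"
    (is "limsup ?R \<le> ?Q")
proof -
  let ?E = "\<lambda>n. \<integral>\<^sup>+ \<omega>. ennreal ((B n \<omega> - A \<omega>)\<^sup>2) \<partial>M"
  have young: "(y - b)\<^sup>2 \<le> (1 + \<delta>) * (y - a)\<^sup>2 + (1 + 1 / \<delta>) * (b - a)\<^sup>2"
    if "\<delta> > 0" for \<delta> y a b :: real
  proof -
    \<comment> \<open>The gap between the two sides is a square divided by
      \<open>\<delta>\<close>.\<close>
    have "(1 + \<delta>) * (y - a)\<^sup>2 + (1 + 1 / \<delta>) * (b - a)\<^sup>2 - (y - b)\<^sup>2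
        = (\<delta> * (y - a) + (b - a))\<^sup>2 / \<delta>"
      using that by (simp add: field_simps power2_eq_square)
    then show ?thesis
      using that by (smt (verit) divide_nonneg_pos zero_le_power2)
  qed
  have le: "limsup ?R \<le> ennreal (1 + \<delta>) * ?Q" if \<delta>: "\<delta> > 0" for \<delta> :: real
  proof -
    have "?R n \<le> ennreal (1 + \<delta>) * ?Q + ennreal (1 + 1 / \<delta>) * ?E n" for n
    proof -
      have "?R n \<le> (\<integral>\<^sup>+ \<omega>. ennreal (1 + \<delta>) * ennreal ((Y \<omega> - A \<omega>)\<^sup>2)
          + ennreal (1 + 1 / \<delta>) * ennreal ((B n \<omega> - A \<omega>)\<^sup>2) \<partial>M)"
        using \<delta> by (intro nn_integral_mono)
          (auto simp: ennreal_mult[symmetric] ennreal_plus[symmetric] simp del: ennreal_plus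
            intro!: ennreal_leI young)
      also have "\<dots> = ennreal (1 + \<delta>) * ?Q + ennreal (1 + 1 / \<delta>) * ?E n"
        by (simp add: nn_integral_add nn_integral_cmult)
      finally show ?thesis .
    qed
    then have "limsup ?R \<le> limsup (\<lambda>n. ennreal (1 + \<delta>) * ?Q + ennreal (1 + 1 / \<delta>) * ?E n)"
      by (intro Limsup_mono always_eventually allI)
    also have "\<dots> = ennreal (1 + \<delta>) * ?Q + ennreal (1 + 1 / \<delta>) * 0"
      by (intro lim_imp_Limsup tendsto_add tendsto_const ennreal_tendsto_cmult conv) auto
    finally show ?thesis by simp
  qed
  \<comment> \<open>Finiteness turns the limit along \<open>\<delta> = 1 / (m + 1)\<close> into a
    limit of real numbers.\<close>
  obtain c where c: "?Q = ennreal c" "c \<ge> 0"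
    using fin by (cases ?Q) auto
  have "(\<lambda>m. (1 + inverse (real (Suc m))) * c) \<longlonglongrightarrow> (1 + 0) * c"
    by (intro tendsto_intros LIMSEQ_inverse_real_of_nat)
  then have "(\<lambda>m. ennreal ((1 + inverse (real (Suc m))) * c)) \<longlonglongrightarrow> ennreal c"
    by (intro tendsto_ennrealI) simp
  moreover have "limsup ?R \<le> ennreal ((1 + inverse (real (Suc m))) * c)" for m
    using le[of "inverse (real (Suc m))"] c by (simp add: ennreal_mult)
  ultimately show ?thesis
    unfolding c(1) by (intro LIMSEQ_le_const) auto
qed

text \<open>Acyclicity rules out self-loops, so \<open>v\<close> is neither its own parent nor its
  own child; \<open>spouses\<close> removes \<open>v\<close> explicitly.\<close>

lemma markov_blanket_subset:
  assumes "window_causal_graph d \<tau> G"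
  shows "markov_blanket G v \<subseteq> window d \<tau> - {v}"
proof -
  have "G \<subseteq> window d \<tau> \<times> window d \<tau>" "acyclic G"
    using assms by (auto simp: window_causal_graph_def)
  then show ?thesis
    by (auto simp: markov_blanket_def parents_def children_def spouses_def acyclic_def)
qed

lemma predictors_on_mono: "S \<subseteq> S' \<Longrightarrow> predictors_on H S \<subseteq> predictors_on H S'"
  unfolding predictors_on_def by blast

lemma predictors_on_covs:
  assumes "h \<in> predictors_on H S" "S \<subseteq> S'"
  shows "h (covs x t S') = h (covs x t S)"
proof -
  have "\<forall>v\<in>S. covs x t S' v = covs x t S v"
    using assms(2) by (auto simp: covs_def)
  then show ?thesis
    using assms(1) unfolding predictors_on_def by blast
qed

text \<open>This makes risks on different Markov blankets comparable: all of them can be read as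
  risks on one common superset.\<close>

lemma sq_risk_superset:
  assumes "h \<in> predictors_on H S" "S \<subseteq> S'"
  shows "sq_risk M X t j S' h = sq_risk M X t j S h"
  unfolding sq_risk_def using predictors_on_covs[OF assms] by simp

lemma predictors_on_measurable:
  assumes h: "h \<in> predictors_on H S" and H: "H \<subseteq> borel_measurable (Pi\<^sub>M W (\<lambda>_. borel))"
    and S: "S \<subseteq> W"
  shows "h \<in> borel_measurable (Pi\<^sub>M S (\<lambda>_. borel))"
proof -
  \<comment> \<open>\<open>h\<close> is measurable on \<open>W\<close> only, so points of the smaller product are first extended by 0\<close>
  let ?e = "\<lambda>x :: node \<Rightarrow> real. \<lambda>v\<in>W. if v \<in> S then x v else 0"
  have "?e \<in> Pi\<^sub>M S (\<lambda>_. borel) \<rightarrow>\<^sub>M Pi\<^sub>M W (\<lambda>_. borel)"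
  proof (rule measurable_restrict)
    fix v assume "v \<in> W"
    show "(\<lambda>x. if v \<in> S then x v else 0) \<in> Pi\<^sub>M S (\<lambda>_. borel) \<rightarrow>\<^sub>M (borel :: real measure)"
      by (cases "v \<in> S") simp_all
  qed
  moreover have "h \<in> borel_measurable (Pi\<^sub>M W (\<lambda>_. borel))"
    using h H by (auto simp: predictors_on_def)
  ultimately have "(\<lambda>x. h (?e x)) \<in> borel_measurable (Pi\<^sub>M S (\<lambda>_. borel))"
    by (rule measurable_compose)
  moreover have "h (?e x) = h x" for x
  proof -
    have "\<forall>v\<in>S. ?e x v = x v" using S by auto
    then show ?thesis using h unfolding predictors_on_def by blast
  qed
  ultimately show ?thesis by simp
qed

lemma covs_measurable:
  assumes "\<And>s i. i \<in> {1..d} \<Longrightarrow> X s i \<in> borel_measurable M" "S \<subseteq> window d \<tau>"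
  shows "(\<lambda>\<omega>. covs (\<lambda>s i. X s i \<omega>) t S) \<in> M \<rightarrow>\<^sub>M Pi\<^sub>M S (\<lambda>_. borel)"
  unfolding covs_def using assms by (intro measurable_restrict) (auto simp: window_def split_beta)

text \<open>Predictions that agree almost surely have equal risk, so optimality on \<open>S'\<close>
  carries over to \<open>S\<close>. It is applied with the Markov blanket as \<open>S'\<close> and
  the larger covariate set as \<open>S\<close>.\<close>

lemma same_best_predictors_sq_risk_le:
  assumes same: "same_best_predictors M X H t j S S'"
    and h: "h \<in> best_predictors M X H t j S'" and h': "h' \<in> predictors_on H S"
  shows "sq_risk M X t j S' h \<le> sq_risk M X t j S h'"
proof -
  obtain f where f: "f \<in> best_predictors M X H t j S"
    and eq: "AE \<omega> in M. f (covs (\<lambda>s i. X s i \<omega>) t S) = h (covs (\<lambda>s i. X s i \<omega>) t S')"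
    using same h unfolding same_best_predictors_def by blast
  have "sq_risk M X t j S' h = sq_risk M X t j S f"
    unfolding sq_risk_def by (rule nn_integral_cong_AE) (use eq in auto)
  also have "\<dots> \<le> sq_risk M X t j S h'"
    using f h' unfolding best_predictors_def by blast
  finally show ?thesis .
qed

text \<open>The right-hand side is a \<open>liminf\<close>, since convergence is assumed for the
  estimates of regime \<open>k\<close> only; where the limit for \<open>l\<close> exists, it equals
  this \<open>liminf\<close>.\<close>

theorem theorem1:
  fixes M :: "'a measure"
    and d r \<tau> j k :: nat
    and TT :: "int set" and t :: int
    and C :: "int \<Rightarrow> nat"
    and G :: "nat \<Rightarrow> (node \<times> node) set"
    and g :: "nat \<Rightarrow> nat \<Rightarrow> (node \<Rightarrow> real) \<Rightarrow> real \<Rightarrow> real"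
    and \<epsilon> X :: "int \<Rightarrow> nat \<Rightarrow> 'a \<Rightarrow> real"
    and \<omega>\<^sub>0 :: 'a
    and H :: "predictor set"
    and hstar :: "nat \<Rightarrow> nat \<Rightarrow> predictor"
    and hhat :: "nat \<Rightarrow> nat \<Rightarrow> int set \<Rightarrow> predictor"
    and T :: "nat \<Rightarrow> int set"
  assumes series: "regime_time_series M d r \<tau> TT C G g \<epsilon> X"
    and j: "j \<in> {1..d}" and k: "k \<in> {1..r}" and t: "t \<in> TT"
    and predictors: "H \<subseteq> borel_measurable (Pi\<^sub>M (window d \<tau>) (\<lambda>_. borel))"
    \<comment> \<open>the covariates can be restricted to the Markov blanket of the true regime\<close>
    and blanket_suffices:
      "same_best_predictors M X H t j (window d \<tau> - {(j, 0)}) (markov_blanket (G (C t)) (j, 0))"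
    and best: "hstar j k \<in> best_predictors M X H t j (markov_blanket (G k) (j, 0))"
    \<comment> \<open>growing observation sets; the observed values are a realisation of the process\<close>
    and observed: "\<And>n. finite (T n)" "\<And>n. T n \<subseteq> TT"
    and k_grows: "filterlim (\<lambda>n. regime_count C k (T n)) at_top sequentially"
    and realisation: "\<omega>\<^sub>0 \<in> space M"
    and erm: "\<And>m n. m \<in> {1..r} \<Longrightarrow>
      hhat j m (T n) \<in> erm_predictors (\<lambda>s i. X s i \<omega>\<^sub>0) C H (T n) j m (markov_blanket (G m) (j, 0))"
    \<comment> \<open>the three hypotheses proper\<close>
    and regime: "C t = k"
    and bounded_error: "\<exists>B>0. \<forall>\<omega>\<in>space M.
      \<bar>X t j \<omega> - hstar j k (covs (\<lambda>s i. X s i \<omega>) t (markov_blanket (G k) (j, 0)))\<bar> < B"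
    and convergence: "\<And>S. markov_blanket (G k) (j, 0) \<subseteq> S \<Longrightarrow> S \<subseteq> window d \<tau> \<Longrightarrow>
      (\<lambda>n. \<integral>\<^sup>+ s. ennreal ((hhat j k (T n) s - hstar j k s)\<^sup>2) \<partial>covs_distr M X t S)
        \<longlonglongrightarrow> 0"
  shows "convergent (\<lambda>n. sq_risk M X t j (markov_blanket (G k) (j, 0)) (hhat j k (T n))) \<and>
    (\<forall>l\<in>{1..r}. l \<noteq> k \<longrightarrow>
       lim (\<lambda>n. sq_risk M X t j (markov_blanket (G k) (j, 0)) (hhat j k (T n)))
         \<le> liminf (\<lambda>n. sq_risk M X t j (markov_blanket (G l) (j, 0)) (hhat j l (T n))))"
proof -
  interpret regime_time_series M d r \<tau> TT C G g \<epsilon> X by (rule series)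
  define S where "S l = markov_blanket (G l) (j, 0)" for l
  define W where "W = window d \<tau> - {(j, 0)}"
  let ?cov = "\<lambda>S \<omega>. covs (\<lambda>s i. X s i \<omega>) t S"
  let ?R = "\<lambda>l n. sq_risk M X t j (S l) (hhat j l (T n))"
  let ?Q = "sq_risk M X t j (S k) (hstar j k)"

  have SW: "S l \<subseteq> W" if "l \<in> {1..r}" for l
    unfolding S_def W_def using graphs[OF that] by (rule markov_blanket_subset)
  then have Swin: "S k \<subseteq> window d \<tau>" using k by (auto simp: W_def)
  have hhat: "hhat j l (T n) \<in> predictors_on H (S l)" if "l \<in> {1..r}" for l n
    using erm[OF that] by (auto simp: erm_predictors_def S_def)
  have hstar: "hstar j k \<in> predictors_on H (S k)"
    using best by (auto simp: best_predictors_def S_def)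
  \<comment> \<open>Every blanket lies in \<open>W\<close>, so each estimate competes there with the
    optimum. The case \<open>l = k\<close> is included and later gives the lower half of the
    sandwich.\<close>
  have lower: "?Q \<le> ?R l n" if l: "l \<in> {1..r}" for l n
  proof -
    have "hhat j l (T n) \<in> predictors_on H W"
      using hhat[OF l] predictors_on_mono[OF SW[OF l]] by blast
    then have "?Q \<le> sq_risk M X t j W (hhat j l (T n))"
      using blanket_suffices best
      unfolding regime S_def W_def by (rule same_best_predictors_sq_risk_le[rotated 2])
    also have "\<dots> = ?R l n"
      by (rule sq_risk_superset[OF hhat[OF l] SW[OF l]])
    finally show ?thesis .
  qed

  have cov: "?cov (S k) \<in> M \<rightarrow>\<^sub>M Pi\<^sub>M (S k) (\<lambda>_. borel)"
    by (rule covs_measurable[OF random_variables Swin])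
  have meas [measurable]: "hstar j k \<in> borel_measurable (Pi\<^sub>M (S k) (\<lambda>_. borel))"
    "hhat j k (T n) \<in> borel_measurable (Pi\<^sub>M (S k) (\<lambda>_. borel))" for n
    using predictors_on_measurable[OF _ predictors Swin] hstar hhat[OF k] by auto
  have "limsup (?R k) \<le> ?Q"
    unfolding sq_risk_def
  proof (rule limsup_nn_integral_sq_le)
    \<comment> \<open>The bounded error enters only here: the optimal risk is at most the square of
      \<open>B\<close>, as \<open>M\<close> has total mass 1.\<close>
    obtain B where "\<forall>\<omega>\<in>space M. \<bar>X t j \<omega> - hstar j k (?cov (S k) \<omega>)\<bar> < B"
      using bounded_error unfolding S_def by blast
    then have "(\<integral>\<^sup>+ \<omega>. ennreal ((X t j \<omega> - hstar j k (?cov (S k) \<omega>))\<^sup>2) \<partial>M)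
        \<le> (\<integral>\<^sup>+ \<omega>. ennreal (B\<^sup>2) \<partial>M)"
      by (intro nn_integral_mono ennreal_leI) (metis abs_ge_zero less_imp_le power2_abs power_mono)
    also have "\<dots> < \<infinity>" by (simp add: emeasure_space_1)
    finally show "(\<integral>\<^sup>+ \<omega>. ennreal ((X t j \<omega> - hstar j k (?cov (S k) \<omega>))\<^sup>2) \<partial>M) < \<infinity>" .
    show "(\<lambda>n. \<integral>\<^sup>+ \<omega>. ennreal ((hhat j k (T n) (?cov (S k) \<omega>) - hstar j k (?cov (S k) \<omega>))\<^sup>2) \<partial>M)
        \<longlonglongrightarrow> 0"
      \<comment> \<open>The hypothesis is taken at the blanket itself and pulled back from the
        covariate distribution to \<open>M\<close>.\<close>
      using convergence[of "S k"] Swin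
      by (simp add: S_def[symmetric] covs_distr_def nn_integral_distr[OF cov])
  qed (use random_variables j in \<open>auto intro: measurable_compose[OF cov] meas\<close>)
  moreover have minimal: "?Q \<le> liminf (?R l)" if "l \<in> {1..r}" for l
    using lower[OF that] by (intro Liminf_bounded always_eventually allI)
  moreover have "liminf (?R k) \<le> limsup (?R k)"
    by (rule Liminf_le_Limsup) simp
  \<comment> \<open>Sandwich: \<open>?Q\<close> is at most the \<open>liminf\<close>, which is at
    most the \<open>limsup\<close>, which is at most \<open>?Q\<close>.\<close>
  ultimately have "liminf (?R k) = ?Q" "limsup (?R k) = ?Q"
    using k by (meson order.antisym order.trans)+
  then have "?R k \<longlonglongrightarrow> ?Q"
    by (intro Liminf_eq_Limsup) simp_all
  then have "convergent (?R k)" "lim (?R k) = ?Q"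
    by (auto simp: convergent_def limI)
  with minimal show ?thesis
    unfolding S_def by simp
qed

end
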